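(* Let $\lambda>0$, let $M$ be a Poisson distributed random variable with mean $\lambda$, let $G$ be the $G$-transform associated with $Po(\lambda)$, and let $Z$ be a standard Gaussian random variable. Then for every integer $m\ge 0$, $$P(M<m)<P\bigl(Z\le G(m)\bigr)<P(M\le m).$$
   Context: $G$-transform: Let $P_0$ be a probability distribution on the real line with mean $\mu_0$, and consider the 1-dimensional exponential family $P_\beta$ given by $\frac{dP_\beta}{dP_0}(x)=\frac{\exp(\beta x)}{Z(\beta)}$, where $Z(\beta)=\int \exp(\beta x)\,dP_0(x)$ is the partition function. Let $P^{\mu}$ denote the element of this exponential family with mean value $\mu$, and let $D(P\Vert Q)=\int \ln\left(\frac{dP}{dQ}\right)dP$ denote information divergence (natural logarithm). The $G$-transform is the function $$G(x)=\begin{cases}-\left(2D(P^{x}\Vert P_0)\right)^{1/2}, & x<\mu_0,\\ \left(2D(P^{x}\Vert P_0)\right)^{1/2}, & x\ge\mu_0.\end{cases}$$ For $P_0=Po(\lambda)$, the element of the exponential family with mean $x>0$ is $Po(x)$, and for $x=0$ the distribution $P^0=Po(0)$ is the point mass at $0$ (the limiting element). Explicitly, $D(Po(x)\Vert Po(\lambda))=x\ln\frac{x}{\lambda}-x+\lambda$ for $x\ge 0$, with the convention $0\ln 0=0$, and $G(x)$ is the square root of twice this quantity, with negative sign for $x<\lambda$ and positive sign for $x\ge\lambda$. The displayed inequalities in the claim are called the intersection property. *)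

theory Defs
  imports "HOL-Probability.Probability"
begin

text \<open>
  Throughout, \<open>P0\<close> is a probability measure on the Borel sets of the reals, and \<open>\<beta>\<close> ranges over
  the parameters for which the partition function is finite (stated as integrability, because the
  Bochner integral of a non-integrable function is \<open>0\<close>).
\<close>

definition partition_fun :: "real measure \<Rightarrow> real \<Rightarrow> real" where
  "partition_fun P0 \<beta> = (\<integral>x. exp (\<beta> * x) \<partial>P0)"

definition admissible_param :: "real measure \<Rightarrow> real \<Rightarrow> bool" where
  "admissible_param P0 \<beta> \<longleftrightarrow> integrable P0 (\<lambda>x. exp (\<beta> * x))"

definition exp_tilt :: "real measure \<Rightarrow> real \<Rightarrow> real measure" where
  "exp_tilt P0 \<beta> = density P0 (\<lambda>x. ennreal (exp (\<beta> * x) / partition_fun P0 \<beta>))"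

definition exp_family :: "real measure \<Rightarrow> real measure set" where
  "exp_family P0 = {exp_tilt P0 \<beta> | \<beta>. admissible_param P0 \<beta>}"

text \<open>
  Limiting elements, for \<open>\<beta>\<close> tending to plus or minus infinity. The limit is taken setwise; unlike a
  weak limit, a setwise limit is always absolutely continuous with respect to \<open>P0\<close>, so that its
  divergence from \<open>P0\<close> is the integral below. For a Poisson distribution the only
  limiting element is the point mass at \<open>0\<close>, arising at minus infinity.
\<close>

definition exp_family_limit :: "real measure \<Rightarrow> real filter \<Rightarrow> real measure \<Rightarrow> bool" where
  "exp_family_limit P0 F Q \<longleftrightarrow>
     prob_space Q \<and> sets Q = sets P0 \<and>
     (\<forall>\<^sub>F \<beta> in F. admissible_param P0 \<beta>) \<and>
     (\<forall>A\<in>sets P0. ((\<lambda>\<beta>. measure (exp_tilt P0 \<beta>) A) \<longlongrightarrow> measure Q A) F)"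

definition extended_exp_family :: "real measure \<Rightarrow> real measure set" where
  "extended_exp_family P0 =
     exp_family P0 \<union> {Q. exp_family_limit P0 at_bot Q \<or> exp_family_limit P0 at_top Q}"

definition has_mean :: "real measure \<Rightarrow> real \<Rightarrow> bool" where
  "has_mean Q \<mu> \<longleftrightarrow> integrable Q (\<lambda>x. x) \<and> (\<integral>x. x \<partial>Q) = \<mu>"

text \<open>The element with a prescribed mean is unique whenever it exists.\<close>

definition exp_family_elem :: "real measure \<Rightarrow> real \<Rightarrow> real measure" where
  "exp_family_elem P0 \<mu> = (THE Q. Q \<in> extended_exp_family P0 \<and> has_mean Q \<mu>)"

text \<open>
  \<^term>\<open>KL_divergence b M N\<close> integrates the logarithm of \<open>dN/dM\<close> with respect to \<open>N\<close>, hence the swap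
  of arguments; base \<open>exp 1\<close> gives the natural logarithm.
\<close>

definition info_divergence :: "real measure \<Rightarrow> real measure \<Rightarrow> real" where
  "info_divergence P Q = KL_divergence (exp 1) Q P"

definition G_transform :: "real measure \<Rightarrow> real \<Rightarrow> real" where
  "G_transform P0 x =
     (if x < (\<integral>y. y \<partial>P0)
      then - sqrt (2 * info_divergence (exp_family_elem P0 x) P0)
      else sqrt (2 * info_divergence (exp_family_elem P0 x) P0))"

definition Po :: "real \<Rightarrow> real measure" where
  "Po r = distr (measure_pmf (poisson_pmf r)) borel real"

end

theory Submission
  imports Defs "HOL-Real_Asymp.Real_Asymp"
begin

text \<open>
  Fix \<open>m\<close> and let the mean \<open>l\<close> vary. With \<open>x = m\<close>, write \<open>D\<close> for the divergence \<open>x ln (x / l) - x + l\<close>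
  and \<open>G\<close> for its signed square root. Since \<open>dD/dl = (l - x) / l\<close>, we have \<open>dG/dl = - R / l\<close> with
  \<open>R = (x - l) / G\<close>, and the Gaussian density at \<open>G\<close> is a constant multiple of \<open>l ^ m exp (- l)\<close>, just
  like the derivative of the Poisson distribution function in \<open>l\<close>. Hence, up to positive factors, the
  derivatives in \<open>l\<close> of the two differences \<open>P(M \<le> m) - P(Z \<le> G)\<close> and \<open>P(Z \<le> G) - P(M < m)\<close> are
  \<open>c R / l - 1 / m!\<close> and \<open>1 / (m - 1)! - c R\<close>. As \<open>R\<close> increases and \<open>R / l\<close> decreases in \<open>l\<close>, both
  differences first increase and then decrease; being asymptotically nonnegative at both ends of
  \<open>(0, \<infinity>)\<close>, they are positive.
\<close>

subsection \<open>Monotonicity arguments on the half-line\<close>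

text \<open>
  The derivative may fail to exist at \<open>c\<close>; below, \<open>c = m\<close>, where \<open>G\<close> vanishes. The function \<open>g\<close> is a
  minorant that only serves to control \<open>f\<close> near the two ends.
\<close>
lemma positive_if_derivative_changes_sign_once:
  fixes f g w k :: "real \<Rightarrow> real"
  assumes cont: "continuous_on {0<..} f"
    and deriv: "\<And>t. 0 < t \<Longrightarrow> t \<noteq> c \<Longrightarrow> (f has_real_derivative w t * k t) (at t)"
    and w: "\<And>t. 0 < t \<Longrightarrow> w t > 0"
    and k: "\<And>s t. 0 < s \<Longrightarrow> s < t \<Longrightarrow> s \<noteq> c \<Longrightarrow> t \<noteq> c \<Longrightarrow> k t < k s"
    and g0: "(g \<longlongrightarrow> 0) (at_right 0)" and g1: "(g \<longlongrightarrow> 0) at_top"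
    and gf: "\<And>t. 0 < t \<Longrightarrow> g t \<le> f t"
    and x: "0 < x"
  shows "f x > 0"
proof -
  have inc: "f a < f b"
    if ab: "0 < a" "a < b" "c \<notin> {a<..<b}" and pos: "\<And>t. a < t \<Longrightarrow> t < b \<Longrightarrow> k t > 0" for a b
  proof (rule DERIV_pos_imp_increasing_open[OF \<open>a < b\<close>])
    show "continuous_on {a..b} f" using cont by (rule continuous_on_subset) (use ab in auto)
    fix t assume t: "a < t" "t < b"
    then have "0 < t" "t \<noteq> c" using ab by auto
    then show "\<exists>y. (f has_real_derivative y) (at t) \<and> 0 < y"
      using deriv w pos[OF t] by (intro exI[of _ "w t * k t"]) simp
  qed
  have dec: "f b < f a"
    if ab: "0 < a" "a < b" "c \<notin> {a<..<b}" and neg: "\<And>t. a < t \<Longrightarrow> t < b \<Longrightarrow> k t < 0" for a b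
  proof (rule DERIV_neg_imp_decreasing_open[OF \<open>a < b\<close>])
    show "continuous_on {a..b} f" using cont by (rule continuous_on_subset) (use ab in auto)
    fix t assume t: "a < t" "t < b"
    then have "0 < t" "t \<noteq> c" using ab by auto
    then show "\<exists>y. (f has_real_derivative y) (at t) \<and> y < 0"
      using deriv w neg[OF t] by (intro exI[of _ "w t * k t"]) (simp add: mult_pos_neg)
  qed
  show ?thesis
  \<comment> \<open>Either \<open>k\<close> is positive on \<open>(0, x)\<close> off
    \<open>c\<close>, so that \<open>f\<close> increases up to \<open>x\<close>, or it has changed
    sign before \<open>x\<close>, so that \<open>f\<close> decreases from \<open>x\<close> on. The
    limit of \<open>g\<close> at the corresponding end gives only a weak bound; applying it at
    \<open>x/2\<close> or \<open>x+1\<close> and using monotonicity once more makes it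
    strict.\<close>
  proof (cases "\<exists>y. 0 < y \<and> y < x \<and> y \<noteq> c \<and> k y \<le> 0")
    case False
    then have pos: "k t > 0" if "0 < t" "t < x" "t \<noteq> c" for t
      using that by (meson not_le)
    have inc': "f a < f b" if ab: "0 < a" "a < b" "b \<le> x" for a b
    proof (cases "c \<in> {a<..<b}")
      case True
      then have "f a < f c" using True ab by (intro inc pos) auto
      moreover have "f c < f b" using True ab by (intro inc pos) auto
      ultimately show ?thesis by simp
    next
      case F: False
      show ?thesis using ab F by (intro inc pos) auto
    qed
    have "\<forall>\<^sub>F t in at_right 0. g t \<le> f (x/2)"
    proof (rule eventually_at_rightI)
      fix t assume "t \<in> {0<..<x / 2}"
      then show "g t \<le> f (x / 2)" using gf[of t] inc'[of t "x / 2"] by simp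
    qed (use x in simp)
    with g0 have "0 \<le> f (x/2)" by (rule tendsto_upperbound) simp
    also have "f (x/2) < f x" using x by (intro inc') auto
    finally show ?thesis .
  next
    case True
    then obtain y where y: "0 < y" "y < x" "y \<noteq> c" "k y \<le> 0" by auto
    have neg: "k t < 0" if "x \<le> t" "t \<noteq> c" for t
      using k[of y t] y that by auto
    have dec': "f b < f a" if ab: "x \<le> a" "a < b" for a b
    proof (cases "c \<in> {a<..<b}")
      case True
      then have "f c < f a" using ab x True by (intro dec neg) auto
      moreover have "f b < f c" using True ab x by (intro dec neg) auto
      ultimately show ?thesis by simp
    next
      case F: False
      show ?thesis using ab x F by (intro dec neg) auto
    qed
    have "\<forall>\<^sub>F t in at_top. g t \<le> f (x+1)"
      using eventually_gt_at_top[of "x+1"]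
    proof eventually_elim
      case (elim t)
      then show ?case using gf[of t] dec'[of "x+1" t] x by simp
    qed
    with g1 have "0 \<le> f (x+1)" by (rule tendsto_upperbound) simp
    also have "f (x+1) < f x" by (intro dec') auto
    finally show ?thesis .
  qed
qed

text \<open>The derivative settles each side of \<open>c\<close>. Across \<open>c\<close> the value
  \<open>d\<close> separates the two sides, so nothing about \<open>h\<close> at \<open>c\<close>
  itself enters. In the applications \<open>d\<close> is the limit of \<open>h\<close> at a
  removable singularity.\<close>

lemma strict_mono_across_point:
  fixes h :: "real \<Rightarrow> real"
  assumes deriv: "\<And>t. 0 < t \<Longrightarrow> t \<noteq> c \<Longrightarrow> \<exists>y. (h has_real_derivative y) (at t) \<and> 0 < y"
    and left: "\<And>t. 0 < t \<Longrightarrow> t < c \<Longrightarrow> h t < d"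
    and right: "\<And>t. 0 < c \<Longrightarrow> c < t \<Longrightarrow> d < h t"
    and st: "0 < s" "s < t" "s \<noteq> c" "t \<noteq> c"
  shows "h s < h t"
proof (cases "s < c \<and> c < t")
  case True
  then show ?thesis using left[of s] right[of t] st by simp
next
  case False
  then show ?thesis
    using st by (intro DERIV_pos_imp_increasing[OF \<open>s < t\<close>] deriv) auto
qed

subsection \<open>The signed root of the Poisson divergence\<close>

text \<open>With \<open>0 * ln 0 = 0\<close> this is the divergence of \<open>Po x\<close> from \<open>Po l\<close> for all \<open>x \<ge> 0\<close>.\<close>
definition poisson_div :: "real \<Rightarrow> real \<Rightarrow> real" where
  "poisson_div x l = x * ln (x / l) - x + l"

definition poisson_G :: "real \<Rightarrow> real \<Rightarrow> real" where
  "poisson_G x l = sgn (x - l) * sqrt (2 * poisson_div x l)"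

text \<open>At \<open>l = x\<close> this is the default \<open>0 / 0 = 0\<close> and not the limit
  \<open>sqrt x\<close>, hence the hypothesis \<open>l \<noteq> x\<close> in the lemmas about
  it.\<close>

definition poisson_ratio :: "real \<Rightarrow> real \<Rightarrow> real" where
  "poisson_ratio x l = (x - l) / poisson_G x l"

lemma poisson_div_self [simp]: "x > 0 \<Longrightarrow> poisson_div x x = 0"
  by (simp add: poisson_div_def)

text \<open>For \<open>x > 0\<close> this is \<open>ln y < y - 1\<close> at
  \<open>y = l / x \<noteq> 1\<close>; for \<open>x = 0\<close> the divergence is
  \<open>l\<close>.\<close>

lemma poisson_div_pos:
  assumes "x \<ge> 0" "l > 0" "l \<noteq> x" shows "poisson_div x l > 0"
proof (cases "x = 0")
  case False
  with assms have "ln (l / x) < l / x - 1"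
    using ln_le_minus_one[of "l/x"] ln_eq_minus_one[of "l/x"] by (force simp: less_le)
  then have "x * ln (l / x) < x * (l / x - 1)" using False assms by simp
  also have "\<dots> = l - x" using False by (simp add: right_diff_distrib)
  finally show ?thesis using False assms by (simp add: poisson_div_def ln_div algebra_simps)
qed (use assms in \<open>simp add: poisson_div_def\<close>)

lemma poisson_div_deriv:
  assumes "x \<ge> 0" "l > 0"
  shows "(poisson_div x has_real_derivative (l - x) / l) (at l)"
proof (cases "x = 0")
  case True
  with assms show ?thesis unfolding poisson_div_def
    by (auto intro!: derivative_eq_intros)
next
  case False
  with assms show ?thesis unfolding poisson_div_def
    by (auto intro!: derivative_eq_intros simp: field_simps)
qed

lemma power2_poisson_G:
  assumes "x \<ge> 0" "l > 0" "l \<noteq> x" shows "(poisson_G x l)\<^sup>2 = 2 * poisson_div x l"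
  using poisson_div_pos[OF assms] assms by (simp add: poisson_G_def power_mult_distrib sgn_if)

lemma poisson_ratio_pos:
  assumes "x \<ge> 0" "l > 0" "l \<noteq> x" shows "poisson_ratio x l > 0"
  using poisson_div_pos[OF assms] assms
  by (auto simp: poisson_ratio_def poisson_G_def sgn_if field_simps)

lemma poisson_G_deriv:
  assumes "x \<ge> 0" "l > 0" "l \<noteq> x"
  shows "(poisson_G x has_real_derivative - poisson_ratio x l / l) (at l)"
proof -
  \<comment> \<open>The sign is locally constant away from \<open>x\<close>, so it is frozen while
    the root is differentiated. Being 1 or -1 it is its own inverse, which moves it into the
    denominator of the ratio.\<close>
  define s where "s = sgn (x - l)"
  have s: "inverse s = s" using assms by (auto simp: s_def sgn_if)
  have "((\<lambda>l. s * sqrt (2 * poisson_div x l)) has_real_derivative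
      s * ((inverse (sqrt (2 * poisson_div x l)) / 2) * (2 * ((l - x) / l)))) (at l)"
    using poisson_div_pos[OF assms] assms
    by (intro DERIV_cmult DERIV_chain2[OF DERIV_real_sqrt] poisson_div_deriv) auto
  also have "s * ((inverse (sqrt (2 * poisson_div x l)) / 2) * (2 * ((l - x) / l))) =
      - poisson_ratio x l / l"
  proof -
    have "s * ((q / 2) * (2 * ((l - x) / l))) = - ((x - l) * (s * q)) / l" for q
      using assms by (simp add: field_simps)
    then show ?thesis
      unfolding poisson_ratio_def poisson_G_def s_def[symmetric] divide_inverse[of "x - l"]
        inverse_mult_distrib s .
  qed
  finally show ?thesis
  proof (rule has_field_derivative_transform_within_open)
    show "open (if l < x then {..<x} else {x<..})" by simp
    show "l \<in> (if l < x then {..<x} else {x<..})" using assms by simp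
    fix t assume "t \<in> (if l < x then {..<x} else {x<..})"
    then show "s * sqrt (2 * poisson_div x t) = poisson_G x t"
      using assms by (auto simp: poisson_G_def s_def sgn_if split: if_splits)
  qed
qed

lemma poisson_G_isCont:
  assumes "x \<ge> 0" "l > 0" shows "isCont (poisson_G x) l"
proof (cases "l = x")
  case False
  then show ?thesis using poisson_G_deriv assms DERIV_isCont by blast
next
  case True
  \<comment> \<open>At the zero of the divergence the root need not be differentiable, but it is
    continuous and bounds the absolute value of \<open>poisson_G\<close>.\<close>
  have "isCont (\<lambda>t. sqrt (2 * poisson_div x t)) x"
    using DERIV_isCont[OF poisson_div_deriv[of x x]] True assms
    by (auto intro!: continuous_intros)
  then have "((\<lambda>t. \<bar>sqrt (2 * poisson_div x t)\<bar>) \<longlongrightarrow> 0) (at x)"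
    using True assms by (intro tendsto_rabs_zero) (simp add: isCont_def)
  then have "(poisson_G x \<longlongrightarrow> 0) (at x)"
    by (rule Lim_null_comparison[rotated])
       (auto simp: poisson_G_def abs_mult abs_sgn_eq intro!: always_eventually)
  then show ?thesis using True assms by (simp add: isCont_def poisson_G_def)
qed

section \<open>Monotonicity of R and of R / l\<close>

lemma poisson_ratio_squared:
  assumes "x \<ge> 0" "l > 0" "l \<noteq> x"
  shows "(poisson_ratio x l)\<^sup>2 = (l - x)\<^sup>2 / (2 * poisson_div x l)"
  using power2_poisson_G[OF assms]
  by (simp add: poisson_ratio_def power_divide power2_commute)

text \<open>
  Up to positive factors, the left-hand sides of this lemma and the next are the logarithmic
  derivatives of \<open>R\<^sup>2\<close> and \<open>(R / l)\<^sup>2\<close> in \<open>l\<close>; the same inequalities also compare these functions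
  with their values \<open>x\<close> and \<open>1 / x\<close> at the removable singularity \<open>l = x\<close>.
\<close>
lemma poisson_div_deviation_pos:
  assumes "x \<ge> 0" "l > 0" "l \<noteq> x"
  shows "(l - x) * (2 * poisson_div x l - (l - x)\<^sup>2 / l) > 0"
proof -
  \<comment> \<open>For \<open>x > 0\<close>, \<open>E\<close> vanishes at \<open>x\<close> and its
    derivative is a square that is zero only there, so \<open>E\<close> has the sign of
    \<open>l - x\<close>.\<close>
  define E where "E l = 2 * poisson_div x l - (l - x)\<^sup>2 / l" for l
  have E': "(E has_real_derivative ((t - x) / t)\<^sup>2) (at t)" if "t > 0" for t
  proof -
    have "(E has_real_derivative
        2 * ((t - x) / t) - ((2 * (t - x)) * t - (t - x)\<^sup>2) / (t * t)) (at t)"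
      unfolding E_def using that assms
      by (auto intro!: derivative_eq_intros poisson_div_deriv simp: field_simps)
    also have "2 * ((t - x) / t) - ((2 * (t - x)) * t - (t - x)\<^sup>2) / (t * t) = ((t - x) / t)\<^sup>2"
      using that by (simp add: field_simps power2_eq_square)
    finally show ?thesis .
  qed
  show ?thesis
  proof (cases "x = 0")
    case True
    then show ?thesis using assms by (simp add: poisson_div_def power2_eq_square)
  next
    case False
    then have x: "x > 0" "E x = 0" using assms by (auto simp: E_def)
    have E_less: "E a < E b" if "0 < a" "a < b" "x \<notin> {a<..<b}" for a b
    proof (rule DERIV_pos_imp_increasing_open[OF \<open>a < b\<close>])
      show "\<exists>y. (E has_real_derivative y) (at t) \<and> 0 < y" if "a < t" "t < b" for t
      proof -
        have "0 < t" "t \<noteq> x" using that \<open>0 < a\<close> \<open>x \<notin> {a<..<b}\<close> \<open>a < b\<close> by auto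
        then show ?thesis using E'[of t] by (intro exI[of _ "((t - x) / t)\<^sup>2"]) simp
      qed
      show "continuous_on {a..b} E"
        using \<open>0 < a\<close> E' DERIV_isCont
        by (meson atLeastAtMost_iff continuous_at_imp_continuous_on less_le_trans)
    qed
    have "(l - x) * E l > 0"
      using E_less[of l x] E_less[of x l] x assms by (cases "l < x") (auto simp: zero_less_mult_iff)
    then show ?thesis by (simp add: E_def)
  qed
qed

lemma poisson_div_deviation_neg:
  assumes "x \<ge> 0" "l > 0" "l \<noteq> x"
  shows "(l - x) * (2 * x * poisson_div x l - (l - x)\<^sup>2) < 0"
proof -
  \<comment> \<open>For \<open>x > 0\<close>, \<open>E\<close> vanishes at \<open>x\<close> and
    strictly decreases on both sides, so its sign is opposite to that of
    \<open>l - x\<close>.\<close>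
  define E where "E l = 2 * x * poisson_div x l - (l - x)\<^sup>2" for l
  have E': "(E has_real_derivative - (2 * (l - x)\<^sup>2 / l)) (at l)" if "l > 0" for l
  proof -
    have "(E has_real_derivative 2 * x * ((l - x) / l) - 2 * (l - x)) (at l)"
      unfolding E_def using that assms
      by (auto intro!: derivative_eq_intros poisson_div_deriv)
    also have "2 * x * ((l - x) / l) - 2 * (l - x) = - (2 * (l - x)\<^sup>2 / l)"
      using that by (simp add: field_simps power2_eq_square)
    finally show ?thesis .
  qed
  show ?thesis
  proof (cases "x = 0")
    case True
    then show ?thesis using assms by (simp add: poisson_div_def power2_eq_square)
  next
    case False
    then have x: "x > 0" "E x = 0" using assms by (auto simp: E_def)
    have E_less: "E b < E a" if "0 < a" "a < b" "x \<notin> {a<..<b}" for a b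
    proof (rule DERIV_neg_imp_decreasing_open[OF \<open>a < b\<close>])
      show "\<exists>y. (E has_real_derivative y) (at t) \<and> y < 0" if "a < t" "t < b" for t
      proof -
        have "0 < t" "t \<noteq> x" using that \<open>0 < a\<close> \<open>x \<notin> {a<..<b}\<close> \<open>a < b\<close> by auto
        then show ?thesis using E'[of t] by (intro exI[of _ "- (2 * (t - x)\<^sup>2 / t)"]) simp
      qed
      show "continuous_on {a..b} E"
        using \<open>0 < a\<close> E' DERIV_isCont
        by (meson atLeastAtMost_iff continuous_at_imp_continuous_on less_le_trans)
    qed
    have "(l - x) * E l < 0"
      using E_less[of l x] E_less[of x l] x assms by (cases "l < x") (auto simp: mult_less_0_iff)
    then show ?thesis by (simp add: E_def)
  qed
qed

text \<open>The ratio is positive, so its square can be compared instead, which removes the sign and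
  the root. \<open>poisson_div_deviation_pos\<close> gives the sign of the derivative, and
  \<open>poisson_div_deviation_neg\<close> the comparison with the limit \<open>x\<close> of the
  square at the singularity.\<close>

lemma poisson_ratio_strict_mono:
  assumes "x > 0" "0 < s" "s < t" "s \<noteq> x" "t \<noteq> x"
  shows "poisson_ratio x s < poisson_ratio x t"
proof -
  define h where "h t = (t - x)\<^sup>2 / (2 * poisson_div x t)" for t
  have "h s < h t"
  proof (rule strict_mono_across_point[of x h x])
    fix t :: real assume t: "0 < t" "t \<noteq> x"
    let ?D = "poisson_div x t"
    have D: "?D > 0" using poisson_div_pos[of x t] t assms by simp
    have "(h has_real_derivative
        ((2 * (t - x)) * (2 * ?D) - (t - x)\<^sup>2 * (2 * ((t - x) / t))) / ((2 * ?D) * (2 * ?D))) (at t)"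
      unfolding h_def using D t assms
      by (auto intro!: derivative_eq_intros poisson_div_deriv)
    moreover have "(2 * (t - x)) * (2 * ?D) - (t - x)\<^sup>2 * (2 * ((t - x) / t)) =
        2 * ((t - x) * (2 * ?D - (t - x)\<^sup>2 / t))"
      using t by (simp add: field_simps)
    ultimately show "\<exists>y. (h has_real_derivative y) (at t) \<and> 0 < y"
      using poisson_div_deviation_pos[of x t] D t assms by fastforce
  next
    fix t assume t: "0 < t" "t < x"
    then show "h t < x"
      using poisson_div_deviation_neg[of x t] poisson_div_pos[of x t] assms
      by (simp add: h_def mult_less_0_iff divide_less_eq mult_ac)
  next
    fix t assume t: "0 < x" "x < t"
    then show "x < h t"
      using poisson_div_deviation_neg[of x t] poisson_div_pos[of x t] assms
      by (simp add: h_def mult_less_0_iff less_divide_eq mult_ac)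
  qed (use assms in auto)
  then have "(poisson_ratio x s)\<^sup>2 < (poisson_ratio x t)\<^sup>2"
    using assms by (simp add: h_def poisson_ratio_squared)
  then show ?thesis
    using poisson_ratio_pos[of x t] assms by (simp add: power_less_imp_less_base)
qed

text \<open>As for the ratio itself, with the two deviation inequalities exchanging roles; the minus
  sign in \<open>h\<close> turns the decreasing square into an increasing function.\<close>

lemma poisson_ratio_over_strict_antimono:
  assumes "x \<ge> 0" "0 < s" "s < t" "s \<noteq> x" "t \<noteq> x"
  shows "poisson_ratio x t / t < poisson_ratio x s / s"
proof -
  define h where "h t = - ((t - x)\<^sup>2 / (t\<^sup>2 * (2 * poisson_div x t)))" for t
  have "h s < h t"
  \<comment> \<open>For \<open>x = 0\<close> the separating value is the default
    \<open>1 / 0 = 0\<close>, but both comparisons with it are then vacuous.\<close>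
  proof (rule strict_mono_across_point[of x h "- 1 / x"])
    fix t :: real assume t: "0 < t" "t \<noteq> x"
    let ?D = "poisson_div x t"
    have D: "?D > 0" using poisson_div_pos[of x t] t assms by simp
    have "(h has_real_derivative
        - (((2 * (t - x)) * (t\<^sup>2 * (2 * ?D)) - (t - x)\<^sup>2 * ((2 * t) * (2 * ?D) + t\<^sup>2 * (2 * ((t - x) / t))))
          / ((t\<^sup>2 * (2 * ?D)) * (t\<^sup>2 * (2 * ?D))))) (at t)"
      unfolding h_def using D t assms
      by (auto intro!: derivative_eq_intros poisson_div_deriv)
    moreover have "(2 * (t - x)) * (t\<^sup>2 * (2 * ?D)) - (t - x)\<^sup>2 * ((2 * t) * (2 * ?D) + t\<^sup>2 * (2 * ((t - x) / t))) =
        2 * t * ((t - x) * (2 * x * ?D - (t - x)\<^sup>2))"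
      using t by (simp add: field_simps power2_eq_square)
    moreover have "2 * t * ((t - x) * (2 * x * ?D - (t - x)\<^sup>2)) < 0"
      using poisson_div_deviation_neg[of x t] t assms
      by (intro mult_pos_neg[of "2 * t"]) simp_all
    moreover have "(t\<^sup>2 * (2 * ?D)) * (t\<^sup>2 * (2 * ?D)) > 0"
      using D t by simp
    ultimately show "\<exists>y. (h has_real_derivative y) (at t) \<and> 0 < y"
      by (metis divide_neg_pos neg_0_less_iff_less)
  next
    fix t assume t: "0 < t" "t < x"
    then have "2 * poisson_div x t < (t - x)\<^sup>2 / t"
      using poisson_div_deviation_pos[of x t] by (simp add: zero_less_mult_iff)
    then have "t * (2 * poisson_div x t) < (x - t)\<^sup>2"
      using t by (simp add: less_divide_eq power2_commute mult_ac)
    then have "t * (t * (2 * poisson_div x t)) < x * (x - t)\<^sup>2"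
      using t poisson_div_pos[of x t] by (intro mult_strict_mono) auto
    then show "h t < - 1 / x"
      using poisson_div_pos[of x t] t
      by (simp add: h_def field_simps power2_eq_square)
  next
    fix t assume t: "0 < x" "x < t"
    then have "(t - x)\<^sup>2 / t < 2 * poisson_div x t"
      using poisson_div_deviation_pos[of x t] by (simp add: zero_less_mult_iff)
    then have *: "(t - x)\<^sup>2 < t * (2 * poisson_div x t)"
      using t by (simp add: divide_less_eq mult_ac)
    have "x * (t - x)\<^sup>2 \<le> t * (t - x)\<^sup>2" using t by (intro mult_right_mono) auto
    also have "\<dots> < t * (t * (2 * poisson_div x t))" using * t by simp
    finally show "- 1 / x < h t"
      using poisson_div_pos[of x t] t assms
      by (simp add: h_def field_simps power2_eq_square)
  qed (use assms in auto)
  then have "(poisson_ratio x t / t)\<^sup>2 < (poisson_ratio x s / s)\<^sup>2"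
    using assms by (simp add: h_def poisson_ratio_squared power_divide mult_ac)
  then show ?thesis
    using poisson_ratio_pos[of x s] assms by (simp add: power_less_imp_less_base)
qed

subsection \<open>Comparison of the distribution functions\<close>

text \<open>The probability of \<open>{..<n}\<close>, so \<open>P(M \<le> m)\<close> is \<open>poisson_cdf (Suc m)\<close>.\<close>
definition poisson_cdf :: "nat \<Rightarrow> real \<Rightarrow> real" where
  "poisson_cdf n l = (\<Sum>k<n. l ^ k / fact k) * exp (- l)"

text \<open>The derivative telescopes: each summand contributes the previous Poisson weight minus
  its own, and only the last survives.\<close>

lemma poisson_cdf_deriv:
  "(poisson_cdf (Suc n) has_real_derivative - (l ^ n / fact n * exp (- l))) (at l)"
proof (induction n)
  case 0
  show ?case unfolding poisson_cdf_def by (auto intro!: derivative_eq_intros)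
next
  case (Suc n)
  have eq: "poisson_cdf (Suc (Suc n)) = (\<lambda>l. poisson_cdf (Suc n) l + l ^ Suc n / fact (Suc n) * exp (- l))"
    by (simp add: fun_eq_iff poisson_cdf_def distrib_right)
  have "((\<lambda>l. l ^ Suc n / fact (Suc n)) has_real_derivative l ^ n / fact n) (at l)"
    by (rule derivative_eq_intros refl | simp)+
  then have "((\<lambda>l. l ^ Suc n / fact (Suc n) * exp (- l)) has_real_derivative
      l ^ n / fact n * exp (- l) + (- exp (- l)) * (l ^ Suc n / fact (Suc n))) (at l)"
    by (rule DERIV_mult) (auto intro!: derivative_eq_intros)
  from DERIV_add[OF Suc.IH this] show ?case
    unfolding eq by (rule DERIV_cong) simp
qed

lemma poisson_cdf_tendsto_1: "(poisson_cdf (Suc n) \<longlongrightarrow> 1) (at_right 0)"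
proof -
  have "isCont (poisson_cdf (Suc n)) 0"
    using poisson_cdf_deriv by (rule DERIV_isCont)
  moreover have "poisson_cdf (Suc n) 0 = 1"
    by (simp add: poisson_cdf_def power_0_left lessThan_Suc_eq_insert_0 sum.reindex)
  ultimately have "(poisson_cdf (Suc n) \<longlongrightarrow> 1) (at 0)" by (simp add: isCont_def)
  then show ?thesis by (rule filterlim_mono) (auto simp: at_le)
qed

lemma poisson_cdf_tendsto_0: "(poisson_cdf n \<longlongrightarrow> 0) at_top"
proof -
  have "((\<lambda>l::real. (l ^ k / exp l) / fact k) \<longlongrightarrow> 0) at_top" for k
    by (rule tendsto_divide_zero) (rule tendsto_power_div_exp_0)
  then have "((\<lambda>l::real. \<Sum>k<n. (l ^ k / exp l) / fact k) \<longlongrightarrow> 0) at_top"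
    by (intro tendsto_null_sum)
  moreover have "poisson_cdf n = (\<lambda>l. \<Sum>k<n. (l ^ k / exp l) / fact k)"
    by (simp add: fun_eq_iff poisson_cdf_def exp_minus divide_inverse sum_distrib_left mult_ac)
  ultimately show ?thesis by simp
qed

lemma poisson_cdf_nonneg: "l \<ge> 0 \<Longrightarrow> poisson_cdf n l \<ge> 0"
  by (simp add: poisson_cdf_def sum_nonneg)

lemma poisson_cdf_le_1: "l \<ge> 0 \<Longrightarrow> poisson_cdf n l \<le> 1"
proof -
  assume l: "l \<ge> 0"
  have "(\<Sum>k<n. l ^ k / fact k) \<le> exp l"
    using sum_le_suminf[OF summable_exp[of l], of "{..<n}"] l
    by (simp add: exp_def divide_inverse mult_ac)
  then show ?thesis by (simp add: poisson_cdf_def exp_minus field_simps)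
qed

section \<open>The Gaussian distribution function and its derivative\<close>

interpretation std_normal: real_distribution std_normal_distribution
  by (rule real_dist_normal_dist)

lemma measure_density_eq_set_integral:
  fixes f :: "'a \<Rightarrow> real"
  assumes "integrable M f" "\<And>x. f x \<ge> 0" "A \<in> sets M"
  shows "measure (density M f) A = (LINT x:A|M. f x)"
proof -
  have "emeasure (density M f) A = (\<integral>\<^sup>+x. ennreal (indicator A x *\<^sub>R f x) \<partial>M)"
    using assms by (auto simp: emeasure_density indicator_def intro!: nn_integral_cong)
  also have "\<dots> = ennreal (LINT x:A|M. f x)"
    unfolding set_lebesgue_integral_def
    using assms integrable_mult_indicator[of A M f] by (intro nn_integral_eq_integral) auto
  finally show ?thesis
    using assms by (simp add: measure_def set_lebesgue_integral_def)
qed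

text \<open>Subtracting the mass up to \<open>x - 1\<close> leaves the integral of a continuous
  density over a bounded interval, to which the fundamental theorem of calculus applies.\<close>

lemma std_normal_cdf_deriv:
  "(cdf std_normal_distribution has_real_derivative std_normal_density x) (at x)"
proof -
  have cont: "continuous_on S std_normal_density" for S
    unfolding normal_density_def by (intro continuous_intros) auto
  have cdf_eq: "cdf std_normal_distribution y =
      cdf std_normal_distribution (x - 1) + integral {x - 1..y} std_normal_density"
    if y: "y \<in> {x - 1<..<x + 1}" for y
  proof -
    have set_int: "set_integrable lborel {x - 1<..y} std_normal_density"
      using integrable_mult_indicator[OF _ integrable_normal_density[of 1 0], of "{x - 1<..y}"]
      by (simp add: set_integrable_def)
    have "measure std_normal_distribution {x - 1<..y} =
        (LINT t:{x - 1<..y}|lborel. std_normal_density t)"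
      by (rule measure_density_eq_set_integral) auto
    also have "\<dots> = integral {x - 1<..y} std_normal_density"
      by (rule set_borel_integral_eq_integral(2)[OF set_int])
    also have "\<dots> = integral {x - 1..y} std_normal_density"
      by (rule integral_spike_set; rule negligible_subset[OF negligible_sing[of "x - 1"]]) auto
    finally show ?thesis
      using std_normal.cdf_diff_eq[of "x - 1" y] y by simp
  qed
  have "((\<lambda>y. integral {x - 1..y} std_normal_density) has_real_derivative std_normal_density x)
      (at x within {x - 1..x + 1})"
    by (rule integral_has_real_derivative) (auto intro: cont)
  then have "((\<lambda>y. integral {x - 1..y} std_normal_density) has_real_derivative std_normal_density x) (at x)"
    by (simp add: at_within_Icc_at)
  then have "((\<lambda>y. cdf std_normal_distribution (x - 1) + integral {x - 1..y} std_normal_density)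
      has_real_derivative std_normal_density x) (at x)"
    by (auto intro!: derivative_eq_intros)
  then show ?thesis
    by (rule has_field_derivative_transform_within_open[of _ _ _ "{x - 1<..<x + 1}"])
       (auto simp: cdf_eq)
qed

lemma std_normal_cdf_pos: "cdf std_normal_distribution x > 0"
proof -
  have "cdf std_normal_distribution (x - 1) < cdf std_normal_distribution x"
    by (rule DERIV_pos_imp_increasing) (auto intro!: exI std_normal_cdf_deriv normal_density_pos)
  then show ?thesis using std_normal.cdf_nonneg[of "x - 1"] by simp
qed

section \<open>Behaviour at both ends and the two comparisons\<close>

lemma poisson_G_tendsto_at_top:
  assumes "x > 0" shows "filterlim (poisson_G x) at_top (at_right 0)"
proof -
  have "filterlim (\<lambda>l. sqrt (2 * (x * ln (x / l) - x + l))) at_top (at_right 0)"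
    using assms by real_asymp
  moreover have "\<forall>\<^sub>F l in at_right 0. poisson_G x l = sqrt (2 * (x * ln (x / l) - x + l))"
    using assms by (auto intro!: eventually_at_rightI[of _ x] simp: poisson_G_def poisson_div_def)
  ultimately show ?thesis by (subst filterlim_cong[OF refl refl])
qed

lemma poisson_G_tendsto_at_bot:
  assumes "x \<ge> 0" shows "filterlim (poisson_G x) at_bot at_top"
proof -
  have "filterlim (\<lambda>l. - sqrt (2 * (x * ln (x / l) - x + l))) at_bot at_top"
  proof (cases "x = 0")
    case True
    show ?thesis unfolding True by simp real_asymp
  next
    case False
    with assms have "x > 0" by simp
    then show ?thesis by real_asymp
  qed
  moreover have "\<forall>\<^sub>F l in at_top. poisson_G x l = - sqrt (2 * (x * ln (x / l) - x + l))"
    using eventually_gt_at_top[of x]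
    by eventually_elim (auto simp: poisson_G_def poisson_div_def)
  ultimately show ?thesis by (subst filterlim_cong[OF refl refl])
qed

text \<open>The constant \<open>c\<close> of the overview: the reciprocal of
  \<open>sqrt (2 * pi) * (m / e) ^ m\<close>, which is Stirling's approximation to \<open>m!\<close>
  without the factor \<open>sqrt m\<close>. For \<open>m = 0\<close> the convention
  \<open>0 * ln 0 = 0\<close> yields \<open>1 / sqrt (2 * pi)\<close>.\<close>

definition stirling_coeff :: "nat \<Rightarrow> real" where
  "stirling_coeff m = exp (real m - real m * ln (real m)) / sqrt (2 * pi)"

text \<open>Half the square of \<open>poisson_G\<close> is the divergence, and
  \<open>exp (- D)\<close> splits into a factor in \<open>m\<close> alone and
  \<open>l ^ m * exp (- l)\<close>.\<close>

lemma std_normal_density_poisson_G: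
  assumes "l > 0" "l \<noteq> real m"
  shows "std_normal_density (poisson_G (real m) l) = stirling_coeff m * l ^ m * exp (- l)"
proof -
  have "l ^ m = exp (real m * ln l)" using assms by (simp add: exp_of_nat_mult)
  then have "exp (- poisson_div (real m) l) = exp (real m - real m * ln (real m)) * l ^ m * exp (- l)"
    using assms by (cases "m = 0")
      (auto simp: poisson_div_def ln_div exp_add[symmetric] algebra_simps simp flip: exp_minus)
  then show ?thesis
    using power2_poisson_G[of "real m" l] assms
    by (simp add: std_normal_density_def stirling_coeff_def)
qed

lemma stirling_coeff_pos: "stirling_coeff m > 0"
  by (simp add: stirling_coeff_def)

lemma std_normal_cdf_poisson_G_deriv:
  assumes "l > 0" "l \<noteq> real m"
  shows "((\<lambda>l. cdf std_normal_distribution (poisson_G (real m) l)) has_real_derivative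
    - (stirling_coeff m * l ^ m * exp (- l) * (poisson_ratio (real m) l / l))) (at l)"
proof -
  have "(poisson_G (real m) has_real_derivative - poisson_ratio (real m) l / l) (at l)"
    using assms by (intro poisson_G_deriv) auto
  from DERIV_chain2[OF std_normal_cdf_deriv this] show ?thesis
    by (rule DERIV_cong) (simp add: std_normal_density_poisson_G assms)
qed

lemma continuous_on_std_normal_cdf_poisson_G:
  "continuous_on {0<..} (\<lambda>l. cdf std_normal_distribution (poisson_G (real m) l))"
proof (intro continuous_at_imp_continuous_on ballI)
  fix l :: real assume "l \<in> {0<..}"
  then have "isCont (poisson_G (real m)) l" by (simp add: poisson_G_isCont)
  then show "isCont (\<lambda>l. cdf std_normal_distribution (poisson_G (real m) l)) l"
    by (rule isCont_o2) (rule DERIV_isCont[OF std_normal_cdf_deriv])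
qed

lemma continuous_on_poisson_cdf: "continuous_on S (poisson_cdf (Suc n))"
  by (intro continuous_at_imp_continuous_on ballI DERIV_isCont[OF poisson_cdf_deriv])

lemma std_normal_cdf_less_poisson_cdf:
  assumes "l > 0"
  shows "cdf std_normal_distribution (poisson_G (real m) l) < poisson_cdf (Suc m) l"
proof -
  let ?F = "\<lambda>l. cdf std_normal_distribution (poisson_G (real m) l)"
  have "0 < poisson_cdf (Suc m) l - ?F l"
  \<comment> \<open>The minorant uses that the Gaussian term is at most 1 near 0 and that the
    Poisson term is nonnegative near infinity; the switch at 1 is arbitrary. The difference itself
    need not tend to 0: for \<open>m = 0\<close> its limit at 0 is 1/2.\<close>
  proof (rule positive_if_derivative_changes_sign_once[of
        "\<lambda>l. poisson_cdf (Suc m) l - ?F l" "real m" "\<lambda>l. l ^ m * exp (- l)"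
        "\<lambda>l. stirling_coeff m * (poisson_ratio (real m) l / l) - 1 / fact m"
        "\<lambda>l. if l < 1 then poisson_cdf (Suc m) l - 1 else - ?F l"])
    show "continuous_on {0<..} (\<lambda>l. poisson_cdf (Suc m) l - ?F l)"
      by (intro continuous_on_diff continuous_on_std_normal_cdf_poisson_G continuous_on_poisson_cdf)
    show "((\<lambda>l. poisson_cdf (Suc m) l - ?F l) has_real_derivative
        t ^ m * exp (- t) * (stirling_coeff m * (poisson_ratio (real m) t / t) - 1 / fact m)) (at t)"
      if "0 < t" "t \<noteq> real m" for t
      using DERIV_diff[OF poisson_cdf_deriv std_normal_cdf_poisson_G_deriv[OF that], of m]
      by (simp add: algebra_simps)
    show "stirling_coeff m * (poisson_ratio (real m) t / t) - 1 / fact m <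
        stirling_coeff m * (poisson_ratio (real m) s / s) - 1 / fact m"
      if "0 < s" "s < t" "s \<noteq> real m" "t \<noteq> real m" for s t
      using mult_strict_left_mono[OF poisson_ratio_over_strict_antimono[OF _ that] stirling_coeff_pos]
      by simp
    have "((\<lambda>l. poisson_cdf (Suc m) l - 1) \<longlongrightarrow> 0) (at_right 0)"
      using tendsto_diff[OF poisson_cdf_tendsto_1 tendsto_const, of m 1] by simp
    then show "((\<lambda>l. if l < 1 then poisson_cdf (Suc m) l - 1 else - ?F l) \<longlongrightarrow> 0) (at_right 0)"
      by (rule Lim_transform_eventually) (auto intro!: eventually_at_rightI[of _ 1])
    have "((\<lambda>l. - ?F l) \<longlongrightarrow> 0) at_top"
      using tendsto_minus[OF filterlim_compose[OF std_normal.cdf_lim_at_bot poisson_G_tendsto_at_bot]]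
      by simp
    then show "((\<lambda>l. if l < 1 then poisson_cdf (Suc m) l - 1 else - ?F l) \<longlongrightarrow> 0) at_top"
      by (rule Lim_transform_eventually) (use eventually_ge_at_top[of 1] in eventually_elim, simp)
    show "(if t < 1 then poisson_cdf (Suc m) t - 1 else - ?F t) \<le> poisson_cdf (Suc m) t - ?F t"
      if "0 < t" for t
      using that std_normal.cdf_bounded_prob[of "poisson_G (real m) t"]
        poisson_cdf_nonneg[of t "Suc m"] by simp
  qed (use assms in auto)
  then show ?thesis by simp
qed

lemma poisson_cdf_less_std_normal_cdf:
  assumes "l > 0"
  shows "poisson_cdf m l < cdf std_normal_distribution (poisson_G (real m) l)"
proof (cases m)
  \<comment> \<open>The general argument would fail at the left end, since
    \<open>poisson_G 0 l = - sqrt (2 * l)\<close> tends to 0 there; but the Poisson side is an empty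
    sum.\<close>
  case 0
  then show ?thesis by (simp add: poisson_cdf_def std_normal_cdf_pos)
next
  case m: (Suc n)
  let ?F = "\<lambda>l. cdf std_normal_distribution (poisson_G (real m) l)"
  have "0 < ?F l - poisson_cdf m l"
  \<comment> \<open>The weight has exponent \<open>n = m - 1\<close>: the factor
    \<open>1 / l\<close> from the derivative of \<open>poisson_G\<close> is absorbed into
    \<open>l ^ m\<close>, leaving R instead of R / l.\<close>
  proof (rule positive_if_derivative_changes_sign_once[of
        "\<lambda>l. ?F l - poisson_cdf m l" "real m" "\<lambda>l. l ^ n * exp (- l)"
        "\<lambda>l. 1 / fact n - stirling_coeff m * poisson_ratio (real m) l"
        "\<lambda>l. if l < 1 then ?F l - 1 else - poisson_cdf m l"])
    show "continuous_on {0<..} (\<lambda>l. ?F l - poisson_cdf m l)"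
      unfolding m
      by (intro continuous_on_diff continuous_on_std_normal_cdf_poisson_G continuous_on_poisson_cdf)
    show "((\<lambda>l. ?F l - poisson_cdf m l) has_real_derivative
        t ^ n * exp (- t) * (1 / fact n - stirling_coeff m * poisson_ratio (real m) t)) (at t)"
      if "0 < t" "t \<noteq> real m" for t
      using DERIV_diff[OF std_normal_cdf_poisson_G_deriv[OF that] poisson_cdf_deriv, of n] that
      by (simp add: m algebra_simps)
    show "1 / fact n - stirling_coeff m * poisson_ratio (real m) t <
        1 / fact n - stirling_coeff m * poisson_ratio (real m) s"
      if "0 < s" "s < t" "s \<noteq> real m" "t \<noteq> real m" for s t
      using poisson_ratio_strict_mono[OF _ that] stirling_coeff_pos m by simp
    have "((\<lambda>l. ?F l - 1) \<longlongrightarrow> 0) (at_right 0)"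
      using tendsto_diff[OF filterlim_compose[OF std_normal.cdf_lim_at_top_prob
        poisson_G_tendsto_at_top] tendsto_const, of "real m" 1] m by simp
    then show "((\<lambda>l. if l < 1 then ?F l - 1 else - poisson_cdf m l) \<longlongrightarrow> 0) (at_right 0)"
      by (rule Lim_transform_eventually) (auto intro!: eventually_at_rightI[of _ 1])
    have "((\<lambda>l. - poisson_cdf m l) \<longlongrightarrow> 0) at_top"
      using tendsto_minus[OF poisson_cdf_tendsto_0] by simp
    then show "((\<lambda>l. if l < 1 then ?F l - 1 else - poisson_cdf m l) \<longlongrightarrow> 0) at_top"
      by (rule Lim_transform_eventually) (use eventually_ge_at_top[of 1] in eventually_elim, simp)
    show "(if t < 1 then ?F t - 1 else - poisson_cdf m t) \<le> ?F t - poisson_cdf m t"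
      if "0 < t" for t
      using that poisson_cdf_le_1[of t m] std_normal.cdf_nonneg[of "poisson_G (real m) t"] by simp
  qed (use assms in auto)
  then show ?thesis by simp
qed

subsection \<open>The exponential family of a Poisson distribution\<close>

text \<open>Nonnegativity makes the convergent series absolutely convergent, so one summation yields
  integrability and the value together.\<close>

lemma integral_measure_pmf_nat:
  fixes p :: "nat pmf" and f :: "nat \<Rightarrow> real"
  assumes f: "\<And>k. f k \<ge> 0" and s: "(\<lambda>k. pmf p k * f k) sums s"
  shows "integrable (measure_pmf p) f" "integral\<^sup>L (measure_pmf p) f = s"
proof -
  have int: "integrable (count_space UNIV) (\<lambda>k. pmf p k * f k)"
    using s f by (simp add: integrable_count_space_nat_iff abs_mult sums_iff)
  then show "integrable (measure_pmf p) f"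
    by (simp add: measure_pmf_eq_density integrable_density)
  show "integral\<^sup>L (measure_pmf p) f = s"
    using sums_unique2[OF sums_integral_count_space_nat[OF int] s]
    by (simp add: measure_pmf_eq_density integral_density)
qed

lemma exp_sums_real: "(\<lambda>k. x ^ k / fact k) sums exp (x::real)"
  using exp_converges[of x] by (simp add: divide_inverse mult_ac)

lemma poisson_mean_sums:
  assumes "l > 0" shows "(\<lambda>k. pmf (poisson_pmf l) k * real k) sums l"
proof -
  have "(\<lambda>k. (l * exp (- l)) * (l ^ k / fact k)) sums ((l * exp (- l)) * exp l)"
    by (intro sums_mult exp_sums_real)
  then have "(\<lambda>k. pmf (poisson_pmf l) (Suc k) * real (Suc k)) sums l"
    using assms by (simp add: exp_minus field_simps del: of_nat_Suc)
  then show ?thesis by (subst (asm) sums_Suc_iff) simp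
qed

lemma poisson_mgf_sums:
  assumes "l > 0"
  shows "(\<lambda>k. pmf (poisson_pmf l) k * exp (\<beta> * real k)) sums exp (l * exp \<beta> - l)"
proof -
  have "(\<lambda>k. exp (- l) * ((l * exp \<beta>) ^ k / fact k)) sums (exp (- l) * exp (l * exp \<beta>))"
    by (intro sums_mult exp_sums_real)
  moreover have "pmf (poisson_pmf l) k * exp (\<beta> * real k) = exp (- l) * ((l * exp \<beta>) ^ k / fact k)" for k
    using assms by (simp add: power_mult_distrib exp_of_nat_mult[symmetric] mult_ac)
  ultimately show ?thesis by (simp add: exp_diff exp_minus divide_inverse mult_ac)
qed

lemma prob_space_Po: "prob_space (Po l)"
  unfolding Po_def by (intro prob_space.prob_space_distr measure_pmf.prob_space_axioms) simp

lemma sets_Po [simp, measurable_cong]: "sets (Po l) = sets borel"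
  by (simp add: Po_def)

lemma admissible_param_Po: "l > 0 \<Longrightarrow> admissible_param (Po l) \<beta>"
  unfolding admissible_param_def Po_def
  by (subst integrable_distr_eq) (auto intro: integral_measure_pmf_nat(1) poisson_mgf_sums)

lemma partition_fun_Po: "l > 0 \<Longrightarrow> partition_fun (Po l) \<beta> = exp (l * exp \<beta> - l)"
  unfolding partition_fun_def Po_def
  by (subst integral_distr) (auto intro: integral_measure_pmf_nat(2) poisson_mgf_sums)

text \<open>The factor \<open>exp (\<beta> * k)\<close> is absorbed into the power
  \<open>l ^ k\<close>, so tilting multiplies the mean by \<open>exp \<beta>\<close> and stays
  within the Poisson distributions.\<close>

lemma exp_tilt_Po:
  assumes "l > 0" shows "exp_tilt (Po l) \<beta> = Po (l * exp \<beta>)"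
proof -
  have "density (measure_pmf (poisson_pmf l)) (\<lambda>k. ennreal (exp (\<beta> * real k) / exp (l * exp \<beta> - l))) =
      density (count_space UNIV)
        (\<lambda>k. ennreal (pmf (poisson_pmf l) k) * ennreal (exp (\<beta> * real k) / exp (l * exp \<beta> - l)))"
    unfolding measure_pmf_eq_density by (rule density_density_eq) auto
  also have "(\<lambda>k. ennreal (pmf (poisson_pmf l) k) * ennreal (exp (\<beta> * real k) / exp (l * exp \<beta> - l))) =
      (\<lambda>k. ennreal (pmf (poisson_pmf (l * exp \<beta>)) k))"
    using assms
    by (auto simp: ennreal_mult[symmetric] fun_eq_iff power_mult_distrib exp_of_nat_mult[symmetric]
        exp_diff exp_minus field_simps)
  finally show ?thesis
    unfolding exp_tilt_def partition_fun_Po[OF assms]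
    by (simp add: Po_def density_distr measure_pmf_eq_density[of "poisson_pmf (l * exp \<beta>)"])
qed

lemma has_mean_Po: "l > 0 \<Longrightarrow> has_mean (Po l) l"
  using integral_measure_pmf_nat[OF _ poisson_mean_sums[of l]]
  by (simp add: has_mean_def Po_def integrable_distr_eq integral_distr)

lemma has_mean_unique: "has_mean Q a \<Longrightarrow> has_mean Q b \<Longrightarrow> a = b"
  by (simp add: has_mean_def)

lemma has_mean_return: "has_mean (return borel x) x"
  by (simp add: has_mean_def integral_return integrable_iff_bounded nn_integral_return)

section \<open>Setwise limits and the extended exponential family\<close>

lemma measure_Po: "A \<in> sets borel \<Longrightarrow> measure (Po l) A = measure_pmf.prob (poisson_pmf l) {k. real k \<in> A}"
  by (simp add: Po_def measure_distr vimage_def)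

lemma prob_poisson_lessThan:
  assumes "l > 0" shows "measure_pmf.prob (poisson_pmf l) {..<n} = poisson_cdf n l"
  using assms by (simp add: measure_measure_pmf_finite poisson_cdf_def sum_distrib_right)

text \<open>The mass at 0 is \<open>exp (- l)\<close>, which tends to 1; a set containing 0 has at
  least this mass, and one missing 0 at most the complementary mass.\<close>

lemma measure_Po_tendsto_return:
  assumes "A \<in> sets borel"
  shows "((\<lambda>l. measure (Po l) A) \<longlongrightarrow> measure (return borel 0) A) (at_right 0)"
proof -
  have zero: "measure_pmf.prob (poisson_pmf l) {0} = exp (- l)" if "l > 0" for l
    using that by (simp add: measure_pmf_single)
  have lim: "((\<lambda>l::real. exp (- l)) \<longlongrightarrow> 1) (at_right 0)"
    by (rule tendsto_eq_intros refl | simp)+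
  show ?thesis
  proof (cases "0 \<in> A")
    case True
    have "((\<lambda>l. measure (Po l) A) \<longlongrightarrow> 1) (at_right 0)"
    proof (rule tendsto_sandwich[OF _ _ lim tendsto_const])
      show "\<forall>\<^sub>F l in at_right 0. exp (- l) \<le> measure (Po l) A"
        using eventually_at_right_less
      proof eventually_elim
        case (elim l)
        have "measure_pmf.prob (poisson_pmf l) {0} \<le> measure_pmf.prob (poisson_pmf l) {k. real k \<in> A}"
          using True by (intro measure_pmf.finite_measure_mono) auto
        then show ?case using elim assms by (simp add: zero measure_Po)
      qed
      show "\<forall>\<^sub>F l in at_right 0. measure (Po l) A \<le> 1"
        by (simp add: prob_space.prob_le_1[OF prob_space_Po])
    qed
    then show ?thesis using True assms by (simp add: measure_return)
  next
    case False
    have "((\<lambda>l. measure (Po l) A) \<longlongrightarrow> 0) (at_right 0)"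
    proof (rule tendsto_sandwich[OF _ _ tendsto_const])
      show "((\<lambda>l::real. 1 - exp (- l)) \<longlongrightarrow> 0) (at_right 0)"
        using tendsto_diff[OF tendsto_const lim, of 1] by simp
      show "\<forall>\<^sub>F l in at_right 0. measure (Po l) A \<le> 1 - exp (- l)"
        using eventually_at_right_less
      proof eventually_elim
        case (elim l)
        have "measure_pmf.prob (poisson_pmf l) {k. real k \<in> A} \<le> measure_pmf.prob (poisson_pmf l) (- {0})"
          using False by (intro measure_pmf.finite_measure_mono) (auto intro: gr0I)
        also have "\<dots> = 1 - measure_pmf.prob (poisson_pmf l) {0}"
          using measure_pmf.prob_compl[of "{0}" "poisson_pmf l"] by (simp add: Compl_eq_Diff_UNIV)
        finally show ?case using elim assms by (simp add: zero measure_Po)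
      qed
    qed simp
    then show ?thesis using False assms by (simp add: measure_return)
  qed
qed

text \<open>The tilted mean \<open>l * exp \<beta>\<close> tends to 0 from the right, and a setwise
  limit is determined by its values on Borel sets.\<close>

lemma exp_family_limit_Po_at_bot_iff:
  assumes "l > 0" shows "exp_family_limit (Po l) at_bot Q \<longleftrightarrow> Q = return borel 0"
proof -
  have "filterlim (\<lambda>\<beta>. l * exp \<beta>) (at_right 0) at_bot"
    using assms by real_asymp
  then have lim: "((\<lambda>\<beta>. measure (exp_tilt (Po l) \<beta>) A) \<longlongrightarrow> measure (return borel 0) A) at_bot"
    if "A \<in> sets borel" for A
    using filterlim_compose[OF measure_Po_tendsto_return[OF that]] assms by (simp add: exp_tilt_Po)
  show ?thesis
  proof
    assume Q: "exp_family_limit (Po l) at_bot Q"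
    then interpret Q: prob_space Q by (simp add: exp_family_limit_def)
    interpret R: prob_space "return borel (0::real)" by (rule prob_space_return) simp
    show "Q = return borel 0"
    proof (rule measure_eqI)
      show "sets Q = sets (return borel 0)" using Q by (simp add: exp_family_limit_def)
      fix A assume "A \<in> sets Q"
      then have A: "A \<in> sets borel" using Q by (simp add: exp_family_limit_def)
      then have "((\<lambda>\<beta>. measure (exp_tilt (Po l) \<beta>) A) \<longlongrightarrow> measure Q A) at_bot"
        using Q by (simp add: exp_family_limit_def)
      then have "measure Q A = measure (return borel 0) A"
        using lim[OF A] by (rule tendsto_unique[rotated]) simp
      then show "emeasure Q A = emeasure (return borel 0) A"
        by (simp add: Q.emeasure_eq_measure R.emeasure_eq_measure)
    qed
  next
    assume "Q = return borel 0"
    then show "exp_family_limit (Po l) at_bot Q"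
      using lim assms by (simp add: exp_family_limit_def prob_space_return admissible_param_Po)
  qed
qed

text \<open>All mass escapes to infinity: a limit would have distribution function 0 at every
  natural number, contradicting its limit 1.\<close>

lemma not_exp_family_limit_Po_at_top:
  assumes "l > 0" shows "\<not> exp_family_limit (Po l) at_top Q"
proof
  assume Q: "exp_family_limit (Po l) at_top Q"
  then interpret Q: real_distribution Q
    by (simp add: exp_family_limit_def real_distribution_def real_distribution_axioms_def)
  have cdf_0: "cdf Q (real n) = 0" for n
  proof -
    have "filterlim (\<lambda>\<beta>. l * exp \<beta>) at_top at_top" using assms by real_asymp
    from filterlim_compose[OF poisson_cdf_tendsto_0 this]
    have "((\<lambda>\<beta>. poisson_cdf (Suc n) (l * exp \<beta>)) \<longlongrightarrow> 0) at_top" .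
    moreover have "poisson_cdf (Suc n) (l * exp \<beta>) = measure (exp_tilt (Po l) \<beta>) {..real n}" for \<beta>
    proof -
      have "{k. real k \<in> {..real n}} = {..<Suc n}" by auto
      then show ?thesis
        using assms by (simp add: exp_tilt_Po measure_Po flip: prob_poisson_lessThan)
    qed
    moreover have "((\<lambda>\<beta>. measure (exp_tilt (Po l) \<beta>) {..real n}) \<longlongrightarrow> measure Q {..real n}) at_top"
      using Q by (simp add: exp_family_limit_def)
    ultimately show ?thesis
      by (simp add: cdf_def tendsto_unique[OF trivial_limit_at_top_linorder])
  qed
  show False
    using Q.cdf_lim_infty_prob by (simp add: cdf_0 LIMSEQ_const_iff)
qed

lemma exp_family_elem_Po:
  assumes "l > 0" "x \<ge> 0"
  shows "exp_family_elem (Po l) x = (if x = 0 then return borel 0 else Po x)"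
  unfolding exp_family_elem_def
proof (rule the_equality)
  \<comment> \<open>The extended family consists of Poisson distributions of positive mean and the
    point mass at 0, so the mean determines the element.\<close>
  have mem: "Q \<in> extended_exp_family (Po l) \<longleftrightarrow> (\<exists>\<beta>. Q = Po (l * exp \<beta>)) \<or> Q = return borel 0" for Q
    using assms
    by (auto simp: extended_exp_family_def exp_family_def admissible_param_Po exp_tilt_Po
        exp_family_limit_Po_at_bot_iff not_exp_family_limit_Po_at_top)
  show "(if x = 0 then return borel 0 else Po x) \<in> extended_exp_family (Po l) \<and>
      has_mean (if x = 0 then return borel 0 else Po x) x"
  proof (cases "x = 0")
    case True
    then show ?thesis using has_mean_return[of 0] by (simp add: mem)
  next
    case False
    then have "Po x = Po (l * exp (ln (x / l)))" using assms by simp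
    then have "\<exists>\<beta>. Po x = Po (l * exp \<beta>)" ..
    then show ?thesis using False assms by (simp add: mem has_mean_Po)
  qed
  fix Q assume Q: "Q \<in> extended_exp_family (Po l) \<and> has_mean Q x"
  then consider \<beta> where "Q = Po (l * exp \<beta>)" | "Q = return borel 0" using mem[of Q] by metis
  then show "Q = (if x = 0 then return borel 0 else Po x)"
  proof cases
    case 1
    then have "has_mean Q (l * exp \<beta>)" using assms by (simp add: has_mean_Po)
    with Q have "x = l * exp \<beta>" by (auto intro: has_mean_unique)
    then show ?thesis using 1 assms by simp
  next
    case 2
    then have "x = 0" using Q has_mean_return[of 0] has_mean_unique by blast
    then show ?thesis using 2 by simp
  qed
qed

section \<open>Divergences and the explicit G-transform\<close>

lemma info_divergence_Po:
  assumes "l > 0" "x > 0"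
  shows "info_divergence (Po x) (Po l) = poisson_div x l"
proof -
  interpret prob_space "Po l" by (rule prob_space_Po)
  \<comment> \<open>With this parameter \<open>Po x\<close> is a tilt of \<open>Po l\<close>, and
    the logarithm of its density is affine in \<open>y\<close>; integrating it requires only the
    mean of \<open>Po x\<close>.\<close>
  define \<beta> where "\<beta> = ln (x / l)"
  have \<beta>: "l * exp \<beta> = x" using assms by (simp add: \<beta>_def)
  define f where "f y = exp (\<beta> * y) / exp (x - l)" for y
  have f: "Po x = density (Po l) f"
    using exp_tilt_Po[OF assms(1), of \<beta>] assms
    by (simp add: \<beta> exp_tilt_def partition_fun_Po f_def[abs_def])
  have f_meas [measurable]: "f \<in> borel_measurable borel" unfolding f_def by simp
  have ln_f: "log (exp 1) (f y) = \<beta> * y - (x - l)" for y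
    by (simp add: f_def log_def ln_div)
  have "info_divergence (Po x) (Po l) = (\<integral>y. f y * log (exp 1) (f y) \<partial>Po l)"
    unfolding info_divergence_def f by (rule KL_density) (auto simp: f_def)
  also have "\<dots> = (\<integral>y. \<beta> * y - (x - l) \<partial>Po x)"
    unfolding ln_f f by (subst integral_density) (auto simp: f_def)
  also have "\<dots> = \<beta> * x - (x - l)"
  proof -
    interpret X: prob_space "Po x" by (rule prob_space_Po)
    show ?thesis using has_mean_Po[OF assms(2)] by (simp add: has_mean_def X.prob_space)
  qed
  finally show ?thesis by (simp add: poisson_div_def \<beta>_def mult.commute)
qed

lemma info_divergence_return_Po:
  assumes "l > 0"
  shows "info_divergence (return borel 0) (Po l) = l"
proof -
  interpret prob_space "Po l" by (rule prob_space_Po)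
  \<comment> \<open>The density is the reciprocal of the mass \<open>exp (- l)\<close> at 0.
    Elsewhere it is 0, and the integrand \<open>f y * log (exp 1) (f y)\<close> vanishes.\<close>
  define f where "f y = indicator {0::real} y * exp l" for y
  have [measurable]: "f \<in> borel_measurable borel" unfolding f_def by measurable
  have "{k. real k \<in> {0}} = {0}" by auto
  then have zero: "measure (Po l) {0} = exp (- l)"
    using assms by (simp add: measure_Po measure_pmf_single)
  have "return borel 0 = density (Po l) f"
  proof (rule measure_eqI)
    fix A :: "real set" assume "A \<in> sets (return borel 0)"
    then have A [measurable]: "A \<in> sets borel" by simp
    have "emeasure (density (Po l) f) A = (\<integral>\<^sup>+y. ennreal (exp l) * indicator ({0} \<inter> A) y \<partial>Po l)"
      by (auto simp: emeasure_density f_def indicator_def intro!: nn_integral_cong)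
    also have "\<dots> = ennreal (exp l) * emeasure (Po l) ({0} \<inter> A)"
      by (rule nn_integral_cmult_indicator) simp
    also have "\<dots> = indicator A 0"
      by (cases "0 \<in> A") (auto simp: emeasure_eq_measure zero ennreal_mult[symmetric] exp_minus)
    finally show "emeasure (return borel 0) A = emeasure (density (Po l) f) A" by simp
  qed simp
  then have "info_divergence (return borel 0) (Po l) = (\<integral>y. f y * log (exp 1) (f y) \<partial>Po l)"
    unfolding info_divergence_def by simp (rule KL_density, auto simp: f_def)
  also have "\<dots> = (\<integral>y. (l * exp l) * indicator {0} y \<partial>Po l)"
    by (intro Bochner_Integration.integral_cong) (auto simp: f_def log_def indicator_def)
  also have "\<dots> = l" by (simp add: zero exp_minus)
  finally show ?thesis .
qed

text \<open>The two sign conventions differ only at \<open>x = l\<close>, where the divergence is 0;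
  at \<open>x = 0\<close> the formula for the divergence gives \<open>l\<close>, as for the point
  mass.\<close>

lemma G_transform_Po:
  assumes "l > 0" "x \<ge> 0"
  shows "G_transform (Po l) x = poisson_G x l"
proof -
  have "info_divergence (exp_family_elem (Po l) x) (Po l) = poisson_div x l"
    using assms info_divergence_Po[of l x] info_divergence_return_Po[of l]
    by (auto simp: exp_family_elem_Po poisson_div_def)
  moreover have "(\<integral>y. y \<partial>Po l) = l"
    using has_mean_Po[OF assms(1)] by (simp add: has_mean_def)
  ultimately show ?thesis
    using assms by (auto simp: G_transform_def poisson_G_def sgn_if)
qed

theorem theorem8:
  fixes l :: real and m :: nat
    and A :: "'a measure" and M :: "'a \<Rightarrow> nat"
    and B :: "'b measure" and Z :: "'b \<Rightarrow> real"
  assumes "l > 0"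
    and "prob_space A"
    and "M \<in> measurable A (count_space UNIV)"
    and "distr A (count_space UNIV) M = measure_pmf (poisson_pmf l)"
    and "prob_space B"
    and "distributed B lborel Z std_normal_density"
  shows "\<P>(\<omega> in A. M \<omega> < m) < \<P>(\<omega> in B. Z \<omega> \<le> G_transform (Po l) (real m)) \<and>
         \<P>(\<omega> in B. Z \<omega> \<le> G_transform (Po l) (real m)) < \<P>(\<omega> in A. M \<omega> \<le> m)"
proof -
  have M: "\<P>(\<omega> in A. M \<omega> < n) = poisson_cdf n l" for n
  proof -
    have "\<P>(\<omega> in A. M \<omega> < n) = measure (distr A (count_space UNIV) M) {..<n}"
      using assms(3) by (simp add: measure_distr vimage_def Int_def conj_commute)
    then show ?thesis using assms(1,4) by (simp add: prob_poisson_lessThan)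
  qed
  have Z: "\<P>(\<omega> in B. Z \<omega> \<le> z) = cdf std_normal_distribution z" for z
  proof -
    have "\<P>(\<omega> in B. Z \<omega> \<le> z) = measure (distr B lborel Z) {..z}"
      using distributed_measurable[OF assms(6)]
      by (simp add: measure_distr vimage_def Int_def conj_commute)
    then show ?thesis
      by (simp add: cdf_def distributed_distr_eq_density[OF assms(6)])
  qed
  show ?thesis
    using M[of m] M[of "Suc m"] assms(1)
    by (simp add: Z G_transform_Po std_normal_cdf_less_poisson_cdf poisson_cdf_less_std_normal_cdf
        less_Suc_eq_le)
qed

end
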